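(* For every constant $\epsilon_0>0$ there exist constants $c>0$ and $N\in\mathbb{N}$ such that for every $0<\epsilon\le \epsilon_0$ and every integer $n\ge N$, there exists a metric space $\mathcal{M}=(V,d)$ with $|V|=n$ such that every $\epsilon$-differentially private algorithm for the super-set output facility location problem on $\mathcal{M}$ has expected approximation ratio at least $$c\cdot \min\left\{\frac{\log n}{\log\log n},\ \sqrt{\frac{\log n}{\epsilon}}\right\}.$$ In other words, if $\alpha$ is such that an $\epsilon$-DP algorithm $A$ satisfies $\mathbb{E}_{\psi\sim A(\mathbf{X};\mathcal{M},\mathbf{f})}[\mathrm{cost}_{\mathcal{M},\mathbf{f},\mathbf{X}}(\psi)]\le \alpha\cdot \mathrm{opt}_{\mathcal{M},\mathbf{f},\mathbf{X}}$ for all facility costs $\mathbf{f}$ and all client datasets $\mathbf{X}$, then $\alpha\ge c\cdot\min\{\log n/\log\log n,\sqrt{\log n/\epsilon}\}$.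
   Context: Super-set output facility location (SOFL): given a finite metric space $\mathcal{M}=(V,d)$, facility costs $\mathbf{f}=(f_v)_{v\in V}$ with $f_v\ge 0$, and a dataset of clients $\mathbf{X}=(x_1,\dots,x_m)\in V^m$, an algorithm outputs a map $\psi:V\to V$. The set of open facilities is $S_{\psi,\mathbf{X}}=\psi(\{x_1,\dots,x_m\})$ and the cost is $\mathrm{cost}_{\mathcal{M},\mathbf{f},\mathbf{X}}(\psi)=\sum_{s\in S_{\psi,\mathbf{X}}} f_s+\sum_{i=1}^m d(x_i,\psi(x_i))$. For a set $S\subseteq V$, $\mathrm{cost}_{\mathcal{M},\mathbf{f},\mathbf{X}}(S)=\sum_{s\in S}f_s+\sum_{i=1}^m\min_{u\in S}d(x_i,u)$, and $\mathrm{opt}_{\mathcal{M},\mathbf{f},\mathbf{X}}=\min_{S\subseteq V}\mathrm{cost}_{\mathcal{M},\mathbf{f},\mathbf{X}}(S)$. A randomized algorithm $A$ (with $\mathcal{M},\mathbf{f}$ fixed, taking $\mathbf{X}$ as its private input) has expected approximation ratio $\alpha$ if $\mathbb{E}_{\psi\sim A(\mathbf{X};\mathcal{M},\mathbf{f})}[\mathrm{cost}_{\mathcal{M},\mathbf{f},\mathbf{X}}(\psi)]\le\alpha\cdot\mathrm{opt}_{\mathcal{M},\mathbf{f},\mathbf{X}}$ for all $\mathbf{f},\mathbf{X}$. Two datasets $\mathbf{X},\mathbf{X}'\in V^m$ are adjacent if they differ in at most one coordinate. $A$ is $\epsilon$-differentially private ($\epsilon$-DP) if for all adjacent $\mathbf{X},\mathbf{X}'$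 and every output $\psi$, $\Pr[A(\mathbf{X})=\psi]\le e^{\epsilon}\Pr[A(\mathbf{X}')=\psi]$. *)

theory Defs
  imports "HOL-Probability.Probability"
begin

definition finite_metric :: "nat set \<Rightarrow> (nat \<Rightarrow> nat \<Rightarrow> real) \<Rightarrow> bool" where
  "finite_metric V d \<longleftrightarrow> finite V \<and>
     (\<forall>u\<in>V. \<forall>v\<in>V. d u v \<ge> 0 \<and> (d u v = 0 \<longleftrightarrow> u = v) \<and> d u v = d v u) \<and>
     (\<forall>u\<in>V. \<forall>v\<in>V. \<forall>w\<in>V. d u w \<le> d u v + d v w)"

definition valid_costs :: "nat set \<Rightarrow> (nat \<Rightarrow> real) \<Rightarrow> bool" where
  "valid_costs V f \<longleftrightarrow> (\<forall>v\<in>V. f v \<ge> 0)"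

definition valid_data :: "nat set \<Rightarrow> nat list \<Rightarrow> bool" where
  "valid_data V X \<longleftrightarrow> set X \<subseteq> V"

definition cost_map :: "(nat \<Rightarrow> nat \<Rightarrow> real) \<Rightarrow> (nat \<Rightarrow> real) \<Rightarrow> nat list \<Rightarrow> (nat \<Rightarrow> nat) \<Rightarrow> real" where
  "cost_map d f X \<psi> = (\<Sum>s\<in>\<psi> ` set X. f s) + (\<Sum>x\<leftarrow>X. d x (\<psi> x))"

definition cost_set :: "(nat \<Rightarrow> nat \<Rightarrow> real) \<Rightarrow> (nat \<Rightarrow> real) \<Rightarrow> nat list \<Rightarrow> nat set \<Rightarrow> real" where
  "cost_set d f X S = (\<Sum>s\<in>S. f s) + (\<Sum>x\<leftarrow>X. Min (d x ` S))"

text \<open>Optimum over subsets S of V; the empty set is allowed only when there are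
  no clients (otherwise its connection cost is infinite).\<close>
definition opt_cost :: "nat set \<Rightarrow> (nat \<Rightarrow> nat \<Rightarrow> real) \<Rightarrow> (nat \<Rightarrow> real) \<Rightarrow> nat list \<Rightarrow> real" where
  "opt_cost V d f X = Min {cost_set d f X S | S. S \<subseteq> V \<and> (S \<noteq> {} \<or> X = [])}"

definition adjacent :: "nat list \<Rightarrow> nat list \<Rightarrow> bool" where
  "adjacent X X' \<longleftrightarrow> length X = length X' \<and> card {i. i < length X \<and> X ! i \<noteq> X' ! i} \<le> 1"

type_synonym algo = "(nat \<Rightarrow> real) \<Rightarrow> nat list \<Rightarrow> (nat \<Rightarrow> nat) pmf"

definition valid_algo :: "nat set \<Rightarrow> algo \<Rightarrow> bool" where
  "valid_algo V A \<longleftrightarrow> (\<forall>f X. valid_costs V f \<longrightarrow> valid_data V X \<longrightarrow>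
      set_pmf (A f X) \<subseteq> V \<rightarrow>\<^sub>E V)"

definition is_DP :: "nat set \<Rightarrow> real \<Rightarrow> algo \<Rightarrow> bool" where
  "is_DP V \<epsilon> A \<longleftrightarrow> (\<forall>f X X'. valid_costs V f \<longrightarrow> valid_data V X \<longrightarrow> valid_data V X' \<longrightarrow>
      adjacent X X' \<longrightarrow> (\<forall>\<psi>. pmf (A f X) \<psi> \<le> exp \<epsilon> * pmf (A f X') \<psi>))"

definition has_approx_ratio :: "nat set \<Rightarrow> (nat \<Rightarrow> nat \<Rightarrow> real) \<Rightarrow> algo \<Rightarrow> real \<Rightarrow> bool" where
  "has_approx_ratio V d A \<alpha> \<longleftrightarrow> (\<forall>f X. valid_costs V f \<longrightarrow> valid_data V X \<longrightarrow>
      measure_pmf.expectation (A f X) (cost_map d f X) \<le> \<alpha> * opt_cost V d f X)"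

end

theory Submission
  imports Defs "HOL-Real_Asymp.Real_Asymp"
begin

text \<open>
  The metric is the shortest-path metric, with edges of length \<open>1/k\<close> and truncated at \<open>1\<close>, of a
  graph of girth above \<open>2k + 1\<close> in which at least half of the \<open>n\<close> vertices have degree \<open>k m\<close>, where
  \<open>m \<ge> 4 exp (\<epsilon> k)\<close>; all facilities cost \<open>1\<close>. Serving \<open>k\<close> neighbours of a vertex \<open>v\<close> from \<open>v\<close>
  costs only \<open>2\<close>. For a fixed output \<open>\<psi>\<close>, call a neighbour \<open>u\<close> of \<open>v\<close> bad if \<open>v\<close> is closer to \<open>\<psi> u\<close> than \<open>u\<close> is.
  By the girth bound, clients at neighbours of \<open>v\<close> that are not bad cannot share a facility within
  distance less than \<open>1\<close>, so without bad clients the cost is at least \<open>k\<close>; moreover each \<open>u\<close> is bad for at most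
  one \<open>v\<close>. Hence a random block of \<open>k\<close> neighbours contains a bad one with probability at most
  \<open>2/m\<close> when the algorithm is run on a fixed dataset, thus, by group privacy, with probability at most
  \<open>2 exp (\<epsilon> k) / m \<le> 1/2\<close> when it is run on the block. So the ratio is at least \<open>k/4\<close>, and
  \<open>k\<close> can be taken of order \<open>min (ln n / ln ln n) (sqrt (ln n / \<epsilon>))\<close>.
\<close>

subsection \<open>Graphs of large girth\<close>

definition reach :: "nat \<Rightarrow> ('a \<times> 'a) set \<Rightarrow> 'a \<Rightarrow> 'a \<Rightarrow> bool" where
  "reach l E x y \<longleftrightarrow> (\<exists>j\<le>l. (x, y) \<in> E ^^ j)"

lemma reach_relpow: "(x, y) \<in> E ^^ j \<Longrightarrow> j \<le> l \<Longrightarrow> reach l E x y"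
  unfolding reach_def by blast

lemma reach_refl: "reach l E x x"
  by (rule reach_relpow[of _ _ 0]) auto

lemma reach_edge: "(x, y) \<in> E \<Longrightarrow> 1 \<le> l \<Longrightarrow> reach l E x y"
  by (rule reach_relpow[of _ _ 1]) auto

lemma reach_trans:
  assumes "reach a E x y" "reach b E y z" "a + b \<le> l"
  shows "reach l E x z"
proof -
  from assms obtain i j where "i \<le> a" "(x, y) \<in> E ^^ i" "j \<le> b" "(y, z) \<in> E ^^ j"
    unfolding reach_def by blast
  then show ?thesis
    using assms(3) by (intro reach_relpow[of _ _ "i + j"]) (auto simp: relpow_add)
qed

lemma relpow_mono_rel:
  fixes E F :: "('a \<times> 'a) set"
  shows "E \<subseteq> F \<Longrightarrow> E ^^ j \<subseteq> F ^^ j"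
  by (induction j) auto

lemma reach_mono: "reach a E x y \<Longrightarrow> a \<le> b \<Longrightarrow> E \<subseteq> F \<Longrightarrow> reach b F x y"
  unfolding reach_def by (meson order_trans relpow_mono_rel subsetD)

lemma sym_relpow: "sym E \<Longrightarrow> sym (E ^^ j)"
  by (induction j) (auto simp: sym_conv_converse_eq converse_relcomp relpow_commute)

lemma reach_sym: "sym E \<Longrightarrow> reach l E x y \<Longrightarrow> reach l E y x"
  unfolding reach_def by (meson sym_relpow symD)

text \<open>One use of the new edge is enough: if a walk uses it again, the part in between can be
  cut out, or the endpoint was already reached without it. The strict bound \<open>i + j < l\<close>
  leaves room for the new edge itself.\<close>

lemma reach_insert_edge:
  assumes "reach l (insert (a, b) (insert (b, a) E)) x y"
  shows "reach l E x y \<or>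
    (\<exists>i j. i + j < l \<and> (reach i E x a \<and> reach j E b y \<or> reach i E x b \<and> reach j E a y))"
proof -
  let ?F = "insert (a, b) (insert (b, a) E)"
  have "reach n E x y \<or>
    (\<exists>i j. i + j < n \<and> (reach i E x a \<and> reach j E b y \<or> reach i E x b \<and> reach j E a y))"
    if "(x, y) \<in> ?F ^^ n" for n
    using that
  proof (induction n arbitrary: y)
    case 0
    then show ?case by (auto intro: reach_refl)
  next
    case (Suc n)
    from Suc.prems obtain z where z: "(x, z) \<in> ?F ^^ n" "(z, y) \<in> ?F" by auto
    from z(2) consider "(z, y) \<in> E" | "z = a" "y = b" | "z = b" "y = a" by auto
    then show ?case
    proof cases
      case 1
      from Suc.IH[OF z(1)] show ?thesis
      proof (elim disjE exE conjE)
        assume "reach n E x z"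
        then show ?thesis using reach_trans[OF _ reach_edge[OF 1, of 1]] by auto
      next
        fix i j assume "i + j < n" "reach i E x a" "reach j E b z"
        then have "reach (Suc j) E b y" using reach_trans[OF _ reach_edge[OF 1, of 1]] by auto
        with \<open>i + j < n\<close> \<open>reach i E x a\<close> show ?thesis
          by (intro disjI2 exI[of _ i] exI[of _ "Suc j"]) auto
      next
        fix i j assume "i + j < n" "reach i E x b" "reach j E a z"
        then have "reach (Suc j) E a y" using reach_trans[OF _ reach_edge[OF 1, of 1]] by auto
        with \<open>i + j < n\<close> \<open>reach i E x b\<close> show ?thesis
          by (intro disjI2 exI[of _ i] exI[of _ "Suc j"]) auto
      qed
    next
      case 2
      from Suc.IH[OF z(1)] show ?thesis
      proof (elim disjE exE conjE)
        assume "reach n E x z"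
        then show ?thesis using 2
          by (intro disjI2 exI[of _ n] exI[of _ 0]) (auto intro: reach_refl)
      next
        fix i j assume *: "i + j < n" "reach i E x a" "reach j E b z"
        then show ?thesis using 2
          by (intro disjI2 exI[of _ i] exI[of _ 0]) (auto intro: reach_refl)
      next
        fix i j assume *: "i + j < n" "reach i E x b" "reach j E a z"
        then show ?thesis using 2
          using * reach_mono[of i E x b "Suc n" E] by auto
      qed
    next
      case 3
      from Suc.IH[OF z(1)] show ?thesis
      proof (elim disjE exE conjE)
        assume "reach n E x z"
        then show ?thesis using 3
          by (intro disjI2 exI[of _ n] exI[of _ 0]) (auto intro: reach_refl)
      next
        fix i j assume *: "i + j < n" "reach i E x a" "reach j E b z"
        then show ?thesis using 3
          using * reach_mono[of i E x a "Suc n" E] by auto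
      next
        fix i j assume *: "i + j < n" "reach i E x b" "reach j E a z"
        then show ?thesis using 3
          by (intro disjI2 exI[of _ i] exI[of _ 0]) (auto intro: reach_refl)
      qed
    qed
  qed
  moreover obtain n where "n \<le> l" "(x, y) \<in> ?F ^^ n"
    using assms unfolding reach_def by blast
  ultimately have "reach n E x y \<or>
    (\<exists>i j. i + j < n \<and> (reach i E x a \<and> reach j E b y \<or> reach i E x b \<and> reach j E a y))"
    by blast
  then show ?thesis using \<open>n \<le> l\<close> reach_mono[of n E x y l E] by (meson order.strict_trans2 order_refl)
qed

text \<open>Equivalently, there is no cycle of length at most \<open>g + 1\<close>; this form avoids cycles altogether.\<close>
definition high_girth :: "nat \<Rightarrow> ('a \<times> 'a) set \<Rightarrow> bool" where
  "high_girth g E \<longleftrightarrow> (\<forall>p q. (p, q) \<in> E \<longrightarrow> \<not> reach g (E - {(p, q), (q, p)}) p q)"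

text \<open>A short detour around the new edge would be a walk in \<open>E\<close> and contradict
  \<open>far\<close>. A short detour around an old edge must use the new edge, and then the rest of
  the closed walk joins \<open>a\<close> and \<open>b\<close> within \<open>g\<close> steps of
  \<open>E\<close>.\<close>

lemma high_girth_insert_edge:
  assumes girth: "high_girth g E" and "sym E" and far: "\<not> reach g E a b"
  shows "high_girth g (insert (a, b) (insert (b, a) E))" (is "high_girth g ?F")
  unfolding high_girth_def
proof (intro allI impI notI)
  fix p q assume pq: "(p, q) \<in> ?F" and w: "reach g (?F - {(p, q), (q, p)}) p q"
  have far': "\<not> reach g E b a" using far reach_sym[OF \<open>sym E\<close>] by blast
  show False
  proof (cases "(p, q) = (a, b) \<or> (p, q) = (b, a)")
    case True
    then have "reach g E p q" by (intro reach_mono[OF w]) auto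
    then show False using True far far' by auto
  next
    case False
    then have pqE: "(p, q) \<in> E" "(q, p) \<in> E" using pq \<open>sym E\<close> by (auto dest: symD)
    let ?R = "E - {(p, q), (q, p)}"
    have "reach g (insert (a, b) (insert (b, a) ?R)) p q"
      by (rule reach_mono[OF w]) auto
    then consider "reach g ?R p q"
      | i j where "i + j < g" "reach i ?R p a" "reach j ?R b q"
      | i j where "i + j < g" "reach i ?R p b" "reach j ?R a q"
      using reach_insert_edge[of g a b ?R p q] by blast
    then show False
    proof cases
      case 1
      then show False using girth pqE unfolding high_girth_def by blast
    next
      case 2
      have "reach i E p a" "reach j E b q"
        using reach_mono[OF 2(2), of i E] reach_mono[OF 2(3), of j E] by auto
      \<comment> \<open>The closed walk is followed the other way round, through the edge between
        \<open>p\<close> and \<open>q\<close>; the total \<open>i + 1 + j\<close> is at most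
        \<open>g\<close> because \<open>i + j < g\<close>.\<close>
      then have "reach (i + 1) E q a" "reach j E q b"
        using reach_trans[OF reach_edge[OF pqE(2), of 1], of i a "i + 1"]
          reach_sym[OF \<open>sym E\<close>, of j b q] by auto
      then have "reach g E a b"
        using 2(1) reach_sym[OF \<open>sym E\<close>] reach_trans[of "i + 1" E a q j b g] by auto
      then show False using far by blast
    next
      case 3
      have "reach i E p b" "reach j E a q"
        using reach_mono[OF 3(2), of i E] reach_mono[OF 3(3), of j E] by auto
      then have "reach (i + 1) E q b" "reach j E q a"
        using reach_trans[OF reach_edge[OF pqE(2), of 1], of i b "i + 1"]
          reach_sym[OF \<open>sym E\<close>, of j a q] by auto
      then have "reach g E b a"
        using 3(1) reach_sym[OF \<open>sym E\<close>] reach_trans[of "i + 1" E b q j a g] by auto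
      then show False using far' by blast
    qed
  qed
qed

text \<open>Graph distance truncated at \<open>k\<close>: the alternative \<open>l = k\<close> gives
  \<open>LEAST\<close> a witness even for vertices that are not connected.\<close>

definition hop :: "nat \<Rightarrow> ('a \<times> 'a) set \<Rightarrow> 'a \<Rightarrow> 'a \<Rightarrow> nat" where
  "hop k E x y = (LEAST l. l = k \<or> (x, y) \<in> E ^^ l)"

lemma hop_le_cap: "hop k E x y \<le> k"
  unfolding hop_def by (rule Least_le) simp

lemma hop_le: "(x, y) \<in> E ^^ l \<Longrightarrow> hop k E x y \<le> l"
  unfolding hop_def by (rule Least_le) simp

lemma relpow_hop: "hop k E x y < k \<Longrightarrow> (x, y) \<in> E ^^ hop k E x y"
  using LeastI[of "\<lambda>l. l = k \<or> (x, y) \<in> E ^^ l" k] unfolding hop_def by auto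

lemma less_hop: "j < hop k E x y \<Longrightarrow> (x, y) \<notin> E ^^ j"
  using hop_le[of x y j E k] by auto

lemma hop_eq_0_iff: "k > 0 \<Longrightarrow> hop k E x y = 0 \<longleftrightarrow> x = y"
  using relpow_hop[of k E x y] hop_le[of x y 0 E k] by auto

lemma hop_commute: "sym E \<Longrightarrow> hop k E x y = hop k E y x"
  unfolding hop_def by (rule arg_cong[of _ _ Least]) (auto dest: sym_relpow symD)

lemma hop_triangle: "hop k E x z \<le> hop k E x y + hop k E y z"
proof (cases "hop k E x y < k \<and> hop k E y z < k")
  case True
  then show ?thesis
    using relpow_hop[of k E x y] relpow_hop[of k E y z]
    by (intro hop_le) (auto simp: relpow_add)
next
  case False
  then show ?thesis using hop_le_cap[of k E x z] by auto
qed

text \<open>A visit to \<open>x\<close> after the first step would leave a walk from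
  \<open>x\<close> to \<open>c\<close> of fewer than \<open>a\<close> steps.\<close>

lemma relpow_avoid:
  assumes "(y, c) \<in> E ^^ a" "y \<noteq> x" "\<And>j. j < a \<Longrightarrow> (x, c) \<notin> E ^^ j"
  shows "(y, c) \<in> (E - {(p, q). p = x \<or> q = x}) ^^ a"
  using assms
proof (induction a arbitrary: y)
  case (Suc a)
  then obtain z where z: "(y, z) \<in> E" "(z, c) \<in> E ^^ a" by (meson relpow_Suc_E2)
  moreover have "z \<noteq> x" using z Suc.prems(3)[of a] by auto
  ultimately show ?case
    using Suc.IH[of z] Suc.prems by (intro relpow_Suc_I2[of y z]) auto
qed auto

text \<open>Two such neighbours would have walks to \<open>c\<close> that avoid \<open>x\<close>, closing a short cycle through \<open>x\<close>.\<close>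
lemma unique_closer_neighbour:
  assumes "sym E" "irrefl E" and girth: "high_girth (2 * k) E"
    and edges: "(x, y) \<in> E" "(x, y') \<in> E"
    and y: "hop k E y c < k" "hop k E y c \<le> hop k E x c"
    and y': "hop k E y' c < k" "hop k E y' c \<le> hop k E x c"
  shows "y = y'"
proof (rule ccontr)
  assume "y \<noteq> y'"
  let ?R = "E - {(p, q). p = x \<or> q = x}" and ?Q = "E - {(x, y), (y, x)}"
  have "sym ?R" using \<open>sym E\<close> by (auto simp: sym_def)
  have ne: "y \<noteq> x" "y' \<noteq> x" using edges \<open>irrefl E\<close> by (auto simp: irrefl_def)
  have "(y, c) \<in> ?R ^^ hop k E y c" "(y', c) \<in> ?R ^^ hop k E y' c"
    using relpow_avoid[OF relpow_hop[OF y(1)] ne(1)] relpow_avoid[OF relpow_hop[OF y'(1)] ne(2)]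
      less_hop[of _ k E x c] y(2) y'(2) by (auto dest: less_le_trans)
  then have "reach (k - 1) ?R y c" "reach (k - 1) ?R y' c"
    using y(1) y'(1) by (auto intro: reach_relpow)
  then have "reach (k - 1) ?R y c" "reach (k - 1) ?R c y'"
    using reach_sym[OF \<open>sym ?R\<close>] by auto
  then have "reach (2 * k - 1) ?R y y'" by (rule reach_trans) auto
  \<comment> \<open>\<open>?R\<close> has no edge at \<open>x\<close>, so the walk avoids the edge
    between \<open>x\<close> and \<open>y\<close>. Only this edge is missing from \<open>?Q\<close>,
    which still has the edge from \<open>y'\<close> back to \<open>x\<close> and so completes a
    detour of at most \<open>2 * k\<close> steps.\<close>
  then have "reach (2 * k - 1) ?Q y y'" by (rule reach_mono) auto
  moreover have "reach 1 ?Q y' x"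
    using edges \<open>sym E\<close> \<open>y \<noteq> y'\<close> ne by (intro reach_edge) (auto dest: symD)
  ultimately have "reach (2 * k) ?Q y x" by (rule reach_trans) (use y(1) in auto)
  moreover have "(y, x) \<in> E" "?Q = E - {(y, x), (x, y)}" using edges \<open>sym E\<close> by (auto dest: symD)
  ultimately show False using girth unfolding high_girth_def by metis
qed

section \<open>Ball sizes and edge-maximal graphs\<close>

lemma card_relpow_le:
  fixes E :: "('a \<times> 'a) set"
  assumes "\<And>x. finite (E `` {x})" "\<And>x. card (E `` {x}) \<le> b"
  shows "finite ((E ^^ j) `` {x}) \<and> card ((E ^^ j) `` {x}) \<le> b ^ j"
proof (induction j)
  case (Suc j)
  have eq: "(E ^^ Suc j) `` {x} = (\<Union>y\<in>(E ^^ j) `` {x}. E `` {y})" by auto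
  have "card ((E ^^ Suc j) `` {x}) \<le> (\<Sum>y\<in>(E ^^ j) `` {x}. card (E `` {y}))"
    unfolding eq using Suc by (intro card_UN_le) auto
  also have "\<dots> \<le> card ((E ^^ j) `` {x}) * b"
    using sum_bounded_above[of "(E ^^ j) `` {x}" "\<lambda>y. card (E `` {y})" b] assms(2) by simp
  also have "\<dots> \<le> b ^ j * b" using Suc by (intro mult_right_mono) auto
  finally show ?case using Suc assms(1) unfolding eq by (auto simp: mult.commute)
qed auto

lemma card_reach_le:
  assumes "\<And>x. finite (E `` {x})" "\<And>x. card (E `` {x}) \<le> b" "b > 0"
  shows "finite {y. reach g E x y} \<and> card {y. reach g E x y} \<le> (g + 1) * b ^ g"
proof -
  have eq: "{y. reach g E x y} = (\<Union>j\<in>{..g}. (E ^^ j) `` {x})"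
    unfolding reach_def by auto
  have "card {y. reach g E x y} \<le> (\<Sum>j\<in>{..g}. card ((E ^^ j) `` {x}))"
    unfolding eq by (intro card_UN_le) auto
  also have "\<dots> \<le> (\<Sum>j\<in>{..g}. b ^ g)"
    using card_relpow_le[OF assms(1,2)] assms(3)
    by (intro sum_mono order_trans[OF conjunct2[OF card_relpow_le[OF assms(1,2)]]] power_increasing) auto
  finally show ?thesis using card_relpow_le[OF assms(1,2)] unfolding eq by auto
qed

text \<open>An edge-maximal graph of maximum degree \<open>b\<close> without short cycles: any two vertices of degree
  less than \<open>b\<close> must be close to each other, hence there are few of them.\<close>
lemma high_girth_graph_exists:
  fixes V :: "'a set"
  assumes "finite V" "b > 0" "g > 0"
  obtains E where "E \<subseteq> V \<times> V" "sym E" "irrefl E" "high_girth g E"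
    "\<And>x. card (E `` {x}) \<le> b"
    "card {x\<in>V. card (E `` {x}) < b} \<le> (g + 1) * b ^ g"
proof -
  define G where "G = {E. E \<subseteq> V \<times> V \<and> sym E \<and> irrefl E \<and> high_girth g E \<and>
    (\<forall>x. card (E `` {x}) \<le> b)}"
  have "G \<subseteq> Pow (V \<times> V)" unfolding G_def by auto
  then have "finite G" using \<open>finite V\<close> by (meson finite_Pow_iff finite_SigmaI finite_subset)
  \<comment> \<open>The empty graph shows that the finite family \<open>G\<close> is nonempty, so it
    has a member with the most edges.\<close>
  moreover have "{} \<in> G" unfolding G_def by (auto simp: sym_def irrefl_def high_girth_def)
  ultimately obtain E where E: "E \<in> G" and max: "\<And>E'. E' \<in> G \<Longrightarrow> card E' \<le> card E"
    using Max_in[of "card ` G"] Max_ge[of "card ` G"] by (metis (no_types, lifting) empty_iff finite_imageI image_iff)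
  have EV: "E \<subseteq> V \<times> V" and syE: "sym E" and irr: "irrefl E" and girth: "high_girth g E"
    and deg: "\<And>x. card (E `` {x}) \<le> b" using E unfolding G_def by auto
  have finE: "finite E" using EV \<open>finite V\<close> by (meson finite_SigmaI finite_subset)
  have fin: "finite (E `` {x})" for x using finE by (simp add: finite_Image)
  let ?D = "{x\<in>V. card (E `` {x}) < b}"
  \<comment> \<open>Otherwise the edge between \<open>x\<close> and \<open>y\<close> could be added:
    only these two degrees grow, both were below \<open>b\<close>, and the girth condition survives
    since the two are far apart. \<open>g > 0\<close> ensures that the edge is new.\<close>
  have close: "reach g E x y" if "x \<in> ?D" "y \<in> ?D" for x y
  proof (rule ccontr)
    assume far: "\<not> reach g E x y"
    then have "x \<noteq> y" "(x, y) \<notin> E" using reach_refl[of g E] reach_edge[of x y E g] \<open>g > 0\<close> by auto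
    let ?F = "insert (x, y) (insert (y, x) E)"
    have "card (?F `` {z}) \<le> b" for z
    proof -
      consider "z = x" | "z = y" | "z \<noteq> x" "z \<noteq> y" by blast
      then show ?thesis
      proof cases
        case 1
        have "?F `` {z} = insert y (E `` {x})" using 1 \<open>x \<noteq> y\<close> by auto
        then show ?thesis using that fin by (simp add: card_insert_if)
      next
        case 2
        have "?F `` {z} = insert x (E `` {y})" using 2 \<open>x \<noteq> y\<close> by auto
        then show ?thesis using that fin by (simp add: card_insert_if)
      next
        case 3
        then have "?F `` {z} = E `` {z}" by auto
        then show ?thesis using deg by simp
      qed
    qed
    then have "?F \<in> G"
      using EV syE irr that \<open>x \<noteq> y\<close> high_girth_insert_edge[OF girth syE far]
      unfolding G_def by (auto simp: sym_def irrefl_def)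
    from max[OF this] have "card ?F \<le> card E" .
    moreover have "card (insert (x, y) E) \<le> card ?F" using finE by (intro card_mono) auto
    ultimately show False using \<open>(x, y) \<notin> E\<close> finE by simp
  qed
  have "card ?D \<le> (g + 1) * b ^ g"
  proof (cases "?D = {}")
    case False
    then obtain x where "x \<in> ?D" by blast
    \<comment> \<open>All deficient vertices lie in the ball of radius \<open>g\<close> around any
      one of them.\<close>
    then have "?D \<subseteq> {y. reach g E x y}" using close by auto
    then have "card ?D \<le> card {y. reach g E x y}"
      using card_reach_le[OF fin deg \<open>b > 0\<close>] by (intro card_mono) auto
    then show ?thesis using card_reach_le[OF fin deg \<open>b > 0\<close>, of g x] by linarith
  next
    case True
    show ?thesis unfolding True by simp
  qed
  with that[of E] EV syE irr girth deg show ?thesis by blast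
qed

subsection \<open>Privacy and costs\<close>

text \<open>The pointwise inequality is summed over the event. A nonnegative integral over counting
  measure makes this work for arbitrary \<open>B\<close> without summability conditions.\<close>

lemma is_DP_prob:
  assumes "is_DP V \<epsilon> A" "valid_costs V f" "valid_data V X" "valid_data V Y" "adjacent X Y"
  shows "measure_pmf.prob (A f X) B \<le> exp \<epsilon> * measure_pmf.prob (A f Y) B"
proof -
  have "pmf (A f X) \<psi> \<le> exp \<epsilon> * pmf (A f Y) \<psi>" for \<psi>
    using assms unfolding is_DP_def by blast
  then have le: "ennreal (pmf (A f X) \<psi>) \<le> ennreal (exp \<epsilon>) * ennreal (pmf (A f Y) \<psi>)" for \<psi>
    by (simp add: ennreal_mult[symmetric] ennreal_leI)
  have "emeasure (measure_pmf (A f X)) B = (\<integral>\<^sup>+\<psi>. ennreal (pmf (A f X) \<psi>) \<partial>count_space B)"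
    by (simp add: nn_integral_pmf)
  also have "\<dots> \<le> (\<integral>\<^sup>+\<psi>. ennreal (exp \<epsilon>) * ennreal (pmf (A f Y) \<psi>) \<partial>count_space B)"
    using le by (intro nn_integral_mono) auto
  also have "\<dots> = ennreal (exp \<epsilon>) * emeasure (measure_pmf (A f Y)) B"
    by (simp add: nn_integral_cmult nn_integral_pmf)
  finally show ?thesis
    by (simp add: measure_pmf.emeasure_eq_measure ennreal_mult[symmetric])
qed

lemma is_DP_group:
  assumes "is_DP V \<epsilon> A" "valid_costs V f"
    and "length X = length Y" "valid_data V X" "valid_data V Y"
  shows "measure_pmf.prob (A f X) B \<le> exp (\<epsilon> * length X) * measure_pmf.prob (A f Y) B"
proof -
  \<comment> \<open>Hybrid argument: \<open>Z 0\<close> is \<open>Y\<close>,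
    \<open>Z (length X)\<close> is \<open>X\<close>, and consecutive hybrids differ at most at one
    position, so each step costs one factor \<open>exp \<epsilon>\<close>.\<close>
  define Z where "Z i = take i X @ drop i Y" for i
  have len: "length (Z i) = length Y" if "i \<le> length X" for i
    using that assms(3) unfolding Z_def by simp
  have valid: "valid_data V (Z i)" for i
    using assms(4,5) set_take_subset[of i X] set_drop_subset[of i Y]
    unfolding valid_data_def Z_def by auto
  have adj: "adjacent (Z (Suc i)) (Z i)" if "Suc i \<le> length X" for i
  proof -
    have "Z (Suc i) ! j = Z i ! j" if "j \<noteq> i" "j < length Y" for j
      using that \<open>Suc i \<le> length X\<close> assms(3) unfolding Z_def by (auto simp: nth_append)
    then have "{j. j < length (Z (Suc i)) \<and> Z (Suc i) ! j \<noteq> Z i ! j} \<subseteq> {i}"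
      using len[OF that] by auto
    then have "card {j. j < length (Z (Suc i)) \<and> Z (Suc i) ! j \<noteq> Z i ! j} \<le> card {i}"
      by (intro card_mono) auto
    then show ?thesis using len[OF that] len[of i] that unfolding adjacent_def by auto
  qed
  have "measure_pmf.prob (A f (Z i)) B \<le> exp (\<epsilon> * i) * measure_pmf.prob (A f Y) B"
    if "i \<le> length X" for i
    using that
  proof (induction i)
    case 0
    then show ?case by (simp add: Z_def)
  next
    case (Suc i)
    have "measure_pmf.prob (A f (Z (Suc i))) B \<le> exp \<epsilon> * measure_pmf.prob (A f (Z i)) B"
      by (rule is_DP_prob[OF assms(1,2) valid valid adj[OF Suc.prems]])
    also have "\<dots> \<le> exp \<epsilon> * (exp (\<epsilon> * i) * measure_pmf.prob (A f Y) B)"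
      using Suc by (intro mult_left_mono) auto
    finally show ?case by (simp add: exp_add algebra_simps)
  qed
  from this[of "length X"] show ?thesis using assms(3) by (simp add: Z_def)
qed

section \<open>Bounds on the optimum\<close>

lemma opt_cost_le:
  assumes "finite V" "S \<subseteq> V" "S \<noteq> {}"
  shows "opt_cost V d f X \<le> cost_set d f X S"
  unfolding opt_cost_def
proof (rule Min_le)
  have "{cost_set d f X S |S. S \<subseteq> V \<and> (S \<noteq> {} \<or> X = [])} \<subseteq> cost_set d f X ` Pow V" by auto
  then show "finite {cost_set d f X S |S. S \<subseteq> V \<and> (S \<noteq> {} \<or> X = [])}"
    using assms(1) by (meson finite_Pow_iff finite_imageI finite_subset)
qed (use assms in auto)

text \<open>This serves to exclude nonpositive ratios. An empty \<open>S\<close> occurs only without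
  clients, so no \<open>Min\<close> over the empty set enters the cost.\<close>

lemma opt_cost_nonneg:
  assumes "finite_metric V d" "valid_costs V f" "valid_data V X" "V \<noteq> {}"
  shows "opt_cost V d f X \<ge> 0"
proof -
  let ?C = "{cost_set d f X S |S. S \<subseteq> V \<and> (S \<noteq> {} \<or> X = [])}"
  have "finite V" using assms(1) unfolding finite_metric_def by blast
  have "?C \<subseteq> cost_set d f X ` Pow V" by auto
  then have "finite ?C" using \<open>finite V\<close> by (meson finite_Pow_iff finite_imageI finite_subset)
  moreover have "?C \<noteq> {}" using assms(4) by blast
  moreover have "cost_set d f X S \<ge> 0" if S: "S \<subseteq> V" "S \<noteq> {} \<or> X = []" for S
  proof -
    have "finite S" using S \<open>finite V\<close> finite_subset by blast
    have "Min (d x ` S) \<ge> 0" if "x \<in> set X" for x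
    proof -
      have "S \<noteq> {}" using S that by auto
      then show ?thesis
        using \<open>finite S\<close> assms(1,3) S that unfolding finite_metric_def valid_data_def
        by (subst Min_ge_iff) (auto simp: subset_iff)
    qed
    moreover have "f s \<ge> 0" if "s \<in> S" for s using S assms(2) that unfolding valid_costs_def by auto
    ultimately show ?thesis unfolding cost_set_def
      by (intro add_nonneg_nonneg sum_nonneg sum_list_nonneg) auto
  qed
  ultimately show ?thesis unfolding opt_cost_def by (subst Min_ge_iff) auto
qed

text \<open>An enumeration of \<open>N\<close> is cut into \<open>m\<close> consecutive stretches of
  length \<open>k\<close>; division with remainder by \<open>k\<close> recovers the stretch and the
  place in it from an index.\<close>

lemma disjoint_blocks_exist:
  assumes "finite N" "card N = k * m"
  obtains X where "\<And>s. s < m \<Longrightarrow> distinct (X s) \<and> length (X s) = k \<and> set (X s) \<subseteq> N"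
    "disjoint_family_on (\<lambda>s. set (X s)) {..<m}"
proof -
  obtain xs where xs: "set xs = N" "distinct xs" using finite_distinct_list[OF assms(1)] by blast
  then have len: "length xs = k * m" using assms(2) distinct_card by fastforce
  define X where "X s = map (\<lambda>i. xs ! (s * k + i)) [0..<k]" for s
  have bound: "s * k + i < k * m" if "s < m" "i < k" for s i
  proof -
    have "s * k + i < Suc s * k" using that by simp
    also have "\<dots> \<le> m * k" using that by (intro mult_right_mono) auto
    finally show ?thesis by (simp add: mult.commute)
  qed
  have nth_eq: "xs ! (s * k + i) = xs ! (s' * k + i') \<longleftrightarrow> s = s' \<and> i = i'"
    if "s < m" "i < k" "s' < m" "i' < k" for s i s' i'
  proof -
    have "s = s' \<and> i = i'" if eq: "s * k + i = s' * k + i'"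
    proof -
      have "(s * k + i) div k = s" "(s' * k + i') div k = s'" using \<open>i < k\<close> \<open>i' < k\<close> by auto
      then show ?thesis using eq by auto
    qed
    then show ?thesis using bound[OF that(1,2)] bound[OF that(3,4)] xs(2) len
      by (metis nth_eq_iff_index_eq)
  qed
  show ?thesis
  proof
    fix s assume s: "s < m"
    have "inj_on (\<lambda>i. xs ! (s * k + i)) (set [0..<k])"
      using nth_eq[OF s _ s] by (auto intro!: inj_onI)
    then show "distinct (X s) \<and> length (X s) = k \<and> set (X s) \<subseteq> N"
      using bound[OF s] len xs(1) unfolding X_def by (auto simp: distinct_map)
  next
    show "disjoint_family_on (\<lambda>s. set (X s)) {..<m}"
      unfolding disjoint_family_on_def X_def by (auto simp: nth_eq)
  qed
qed

subsection \<open>The lower bound\<close>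

text \<open>The bound on \<open>m\<close> offsets the privacy loss
  \<open>exp (\<epsilon> * k)\<close> of exchanging \<open>k\<close> clients. The bound on
  \<open>n\<close> is twice the number of vertices that may have deficient degree, so at least half
  have full degree.\<close>

lemma private_facility_location_lower_bound:
  fixes k m n :: nat and \<epsilon> :: real
  assumes "k > 0" and m: "4 * exp (\<epsilon> * k) \<le> m"
    and n: "2 * ((2 * k + 1) * (k * m) ^ (2 * k)) \<le> n"
  shows "\<exists>V d. card V = n \<and> finite_metric V d \<and>
    (\<forall>A \<alpha>. valid_algo V A \<and> is_DP V \<epsilon> A \<and> has_approx_ratio V d A \<alpha> \<longrightarrow> \<alpha> \<ge> k / 4)"
proof -
  have "0 < 4 * exp (\<epsilon> * k)" by simp
  then have "real m > 0" using m by linarith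
  then have "m > 0" by simp
  then have "0 < 2 * ((2 * k + 1) * (k * m) ^ (2 * k))" using \<open>k > 0\<close> by simp
  then have "n > 0" using n by linarith
  define V where "V = {..<n}"
  have "finite V" unfolding V_def by simp
  obtain E where EV: "E \<subseteq> V \<times> V" and E: "sym E" "irrefl E" and girth: "high_girth (2 * k) E"
    and deg: "\<And>x. card (E `` {x}) \<le> k * m"
    and few: "card {x\<in>V. card (E `` {x}) < k * m} \<le> (2 * k + 1) * (k * m) ^ (2 * k)"
    using high_girth_graph_exists[of V "k * m" "2 * k"] \<open>k > 0\<close> \<open>m > 0\<close> unfolding V_def by auto
  have finN: "finite (E `` {v})" for v
    using EV unfolding V_def by (meson finite_Image finite_SigmaI finite_lessThan finite_subset)
  note closer = unique_closer_neighbour[OF E girth]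

  \<comment> \<open>The scaling makes \<open>k\<close> clients at neighbours of one facility pay at
    most \<open>1\<close> together, while a client at truncated distance pays \<open>1\<close>, the
    price of a facility.\<close>
  define d :: "nat \<Rightarrow> nat \<Rightarrow> real" where "d x y = hop k E x y / k" for x y
  have d_nonneg: "d x y \<ge> 0" for x y unfolding d_def by simp
  have triangle: "d u w \<le> d u v + d v w" for u v w
    using hop_triangle[of k E u w v] unfolding d_def
    by (simp add: add_divide_distrib[symmetric] divide_right_mono flip: of_nat_add)
  have commute: "d u v = d v u" for u v
    unfolding d_def using hop_commute[OF E(1)] by metis
  have eq_0: "d u v = 0 \<longleftrightarrow> u = v" for u v
    using \<open>k > 0\<close> by (simp add: d_def hop_eq_0_iff)
  have metric: "finite_metric V d"
    unfolding finite_metric_def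
    by (intro conjI ballI) (rule \<open>finite V\<close> d_nonneg triangle commute eq_0)+

  \<comment> \<open>Vertices of full degree and their client blocks\<close>
  define F where "F = {v\<in>V. card (E `` {v}) = k * m}"
  have "V = F \<union> {x\<in>V. card (E `` {x}) < k * m}"
    using deg unfolding F_def by (auto simp: order_le_less)
  then have "n \<le> card F + card {x\<in>V. card (E `` {x}) < k * m}"
    using card_Un_le[of F] by (metis (no_types) V_def card_lessThan)
  then have cardF: "n \<le> 2 * card F" using few n by linarith
  have "finite F" unfolding F_def V_def by simp

  let ?blocks = "\<lambda>v X. (\<forall>s<m. distinct (X s) \<and> length (X s) = k \<and> set (X s) \<subseteq> E `` {v}) \<and>
    disjoint_family_on (\<lambda>s. set (X s)) {..<m}"
  have "\<forall>v\<in>F. \<exists>X. ?blocks v X"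
  proof
    fix v assume "v \<in> F"
    then have "card (E `` {v}) = k * m" unfolding F_def by simp
    from disjoint_blocks_exist[OF finN this] show "\<exists>X. ?blocks v X" by metis
  qed
  from bchoice[OF this] obtain X where "\<forall>v\<in>F. ?blocks v (X v)" ..
  then have X: "\<And>v s. v \<in> F \<Longrightarrow> s < m \<Longrightarrow>
      distinct (X v s) \<and> length (X v s) = k \<and> set (X v s) \<subseteq> E `` {v}"
    and disj: "\<And>v. v \<in> F \<Longrightarrow> disjoint_family_on (\<lambda>s. set (X v s)) {..<m}"
    by simp_all

  \<comment> \<open>A pair \<open>(v, s)\<close> stands for the block \<open>X v s\<close>. Strict
    inequality suits both uses of \<open>closer\<close>: with the cap it gives distance below
    \<open>k\<close> from \<open>v\<close>, and its negation is the weak inequality needed for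
    clients that are not bad.\<close>
  define bad where "bad p = {\<psi>. \<exists>u\<in>set (X (fst p) (snd p)). hop k E (fst p) (\<psi> u) < hop k E u (\<psi> u)}" for p
  let ?P = "F \<times> {..<m}" and ?f = "\<lambda>_. 1 :: real"

  \<comment> \<open>Each bad pair is charged to a bad client \<open>w p\<close>. The client
    determines \<open>v\<close>, the only neighbour closer to its facility, and then
    \<open>s\<close>, since the blocks of \<open>v\<close> are disjoint; so the charging is
    injective into \<open>V\<close>.\<close>
  have few_bad: "card {p\<in>?P. \<psi> \<in> bad p} \<le> n" for \<psi>
  proof -
    have "\<forall>p\<in>{p\<in>?P. \<psi> \<in> bad p}. \<exists>u. u \<in> set (X (fst p) (snd p)) \<and>
        hop k E (fst p) (\<psi> u) < hop k E u (\<psi> u)" unfolding bad_def by auto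
    then obtain w where w: "\<And>p. p \<in> ?P \<Longrightarrow> \<psi> \<in> bad p \<Longrightarrow> w p \<in> set (X (fst p) (snd p)) \<and>
        hop k E (fst p) (\<psi> (w p)) < hop k E (w p) (\<psi> (w p))"
      by (metis (no_types, lifting) mem_Collect_eq)
    have w_edge: "(w p, fst p) \<in> E" if "p \<in> ?P" "\<psi> \<in> bad p" for p
    proof -
      have "w p \<in> E `` {fst p}" using w[OF that] X[of "fst p" "snd p"] that(1) by auto
      then show ?thesis using E(1) by (auto dest: symD)
    qed
    have "inj_on w {p\<in>?P. \<psi> \<in> bad p}"
    proof (rule inj_onI)
      fix p q assume p: "p \<in> {p\<in>?P. \<psi> \<in> bad p}" and q: "q \<in> {p\<in>?P. \<psi> \<in> bad p}" and eq: "w p = w q"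
      have "hop k E (w p) (\<psi> (w p)) \<le> k" by (rule hop_le_cap)
      then have "fst p = fst q"
        using p q w[of p] w[of q] w_edge[of p] w_edge[of q] eq
        by (intro closer[of "w p" _ _ "\<psi> (w p)"]) auto
      moreover have "snd p = snd q"
      proof (rule ccontr)
        assume "snd p \<noteq> snd q"
        then have "set (X (fst p) (snd p)) \<inter> set (X (fst p) (snd q)) = {}"
          using p q by (intro disjoint_family_onD[OF disj]) auto
        then show False using w[of p] w[of q] p q eq \<open>fst p = fst q\<close> by auto
      qed
      ultimately show "p = q" by (rule prod_eqI)
    qed
    moreover have "w ` {p\<in>?P. \<psi> \<in> bad p} \<subseteq> V" using w_edge EV by auto
    ultimately have "card {p\<in>?P. \<psi> \<in> bad p} \<le> card V"
      by (intro card_inj_on_le[of w]) (auto simp: V_def)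
    then show ?thesis by (simp add: V_def)
  qed

  \<comment> \<open>Here \<open>closer\<close> is applied around \<open>v\<close>: clients with a
    facility at distance below \<open>1\<close> cannot share it, so each accounts for an opening
    cost of \<open>1\<close>. Every other client pays a connection cost of \<open>1\<close>.\<close>
  have cost_good: "cost_map d ?f (X v s) \<psi> \<ge> k" if vs: "v \<in> F" "s < m" and "\<psi> \<notin> bad (v, s)" for v s \<psi>
  proof -
    let ?U = "set (X v s)"
    define near where "near = {u\<in>?U. hop k E u (\<psi> u) < k}"
    note Xvs = X[OF vs]
    have "inj_on \<psi> near"
    proof (rule inj_onI)
      fix u u' assume "u \<in> near" "u' \<in> near" "\<psi> u = \<psi> u'"
      then show "u = u'"
        using Xvs \<open>\<psi> \<notin> bad (v, s)\<close> unfolding near_def bad_def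
        by (intro closer[of v u u' "\<psi> u"]) (auto simp: not_less)
    qed
    then have "card near = card (\<psi> ` near)" by (simp add: card_image)
    also have "\<dots> \<le> card (\<psi> ` ?U)" unfolding near_def by (intro card_mono) auto
    finally have "real (card near) \<le> (\<Sum>s\<in>\<psi> ` ?U. ?f s)" by simp
    moreover have "real (card (?U - near)) \<le> (\<Sum>x\<leftarrow>X v s. d x (\<psi> x))"
    proof -
      have "hop k E u (\<psi> u) = k" if "u \<in> ?U - near" for u
        using that hop_le_cap[of k E u "\<psi> u"] unfolding near_def by auto
      then have "real (card (?U - near)) = (\<Sum>u\<in>?U - near. d u (\<psi> u))"
        using \<open>k > 0\<close> by (simp add: d_def)
      also have "\<dots> \<le> (\<Sum>u\<in>?U. d u (\<psi> u))" using d_nonneg by (intro sum_mono2) auto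
      finally show ?thesis using Xvs by (simp add: sum_list_distinct_conv_sum_set)
    qed
    moreover have "k = card near + card (?U - near)"
    proof -
      have "near \<subseteq> ?U" unfolding near_def by auto
      then have "card ?U = card near + card (?U - near)"
        using card_Diff_subset[of near ?U] card_mono[of ?U near] finite_subset[of near ?U] by auto
      then show ?thesis using Xvs distinct_card by metis
    qed
    ultimately show ?thesis unfolding cost_map_def by (simp add: of_nat_add)
  qed

  \<comment> \<open>Opening only \<open>v\<close> costs \<open>1\<close>, and the \<open>k\<close>
    clients pay at most \<open>1 / k\<close> each.\<close>
  have opt2: "opt_cost V d ?f (X v s) \<le> 2" if vs: "v \<in> F" "s < m" for v s
  proof -
    have "d u v \<le> 1 / k" if "u \<in> set (X v s)" for u
    proof -
      have "u \<in> E `` {v}" using that X[OF vs] by auto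
      then have "(u, v) \<in> E" using E(1) by (auto dest: symD)
      then have "hop k E u v \<le> 1" by (intro hop_le) auto
      then show ?thesis unfolding d_def by (intro divide_right_mono) auto
    qed
    then have "(\<Sum>u\<in>set (X v s). d u v) \<le> (\<Sum>u\<in>set (X v s). 1 / k)" by (intro sum_mono)
    also have "\<dots> = 1" using X[OF vs] \<open>k > 0\<close> distinct_card[of "X v s"] by simp
    finally have "cost_set d ?f (X v s) {v} \<le> 2"
      using X[OF vs] by (simp add: cost_set_def sum_list_distinct_conv_sum_set)
    moreover have "opt_cost V d ?f (X v s) \<le> cost_set d ?f (X v s) {v}"
      using vs unfolding F_def by (intro opt_cost_le) (auto simp: V_def)
    ultimately show ?thesis by linarith
  qed

  \<comment> \<open>Averaging over blocks and transfer by group privacy\<close>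
  have "\<alpha> \<ge> k / 4"
    if valid: "valid_algo V A" and DP: "is_DP V \<epsilon> A" and ratio: "has_approx_ratio V d A \<alpha>" for A \<alpha>
  proof -
    have f: "valid_costs V ?f" unfolding valid_costs_def by simp
    \<comment> \<open>A reference dataset independent of the block; its length is \<open>k\<close>
      because adjacency compares only datasets of equal length.\<close>
    define X\<^sub>0 :: "nat list" where "X\<^sub>0 = replicate k 0"
    have X\<^sub>0: "valid_data V X\<^sub>0" "length X\<^sub>0 = k"
      using \<open>n > 0\<close> unfolding valid_data_def X\<^sub>0_def V_def by auto
    let ?M\<^sub>0 = "measure_pmf (A ?f X\<^sub>0)"
    have "(\<Sum>p\<in>?P. measure ?M\<^sub>0 (bad p)) = (\<integral>\<psi>. (\<Sum>p\<in>?P. indicator (bad p) \<psi>) \<partial>?M\<^sub>0)"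
      by (subst Bochner_Integration.integral_sum) (auto simp: measure_pmf.emeasure_eq_measure)
    also have "\<dots> = (\<integral>\<psi>. real (card {p\<in>?P. \<psi> \<in> bad p}) \<partial>?M\<^sub>0)"
    proof -
      have "(\<Sum>p\<in>?P. indicator (bad p) \<psi>) = real (card {p\<in>?P. \<psi> \<in> bad p})" for \<psi>
        using \<open>finite F\<close> by (simp add: indicator_def sum.If_cases Int_def)
      then show ?thesis by simp
    qed
    also have "\<dots> \<le> (\<integral>\<psi>. real n \<partial>?M\<^sub>0)"
      using few_bad by (intro integral_mono measure_pmf.integrable_const_bound[of _ "real n"]) auto
    finally have sum_le: "(\<Sum>p\<in>?P. measure ?M\<^sub>0 (bad p)) \<le> n" by simp
    \<comment> \<open>The expected number of bad pairs is at most \<open>n\<close>, hence at most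
      \<open>2 * card F\<close>, and there are \<open>card F * m\<close> pairs.\<close>
    have "\<exists>p\<in>?P. measure ?M\<^sub>0 (bad p) \<le> 2 / m"
    proof (rule ccontr)
      assume "\<not> ?thesis"
      then have less: "2 / m < measure ?M\<^sub>0 (bad p)" if "p \<in> ?P" for p using that by (meson not_le)
      have "F \<noteq> {}" using cardF \<open>n > 0\<close> by auto
      then have "?P \<noteq> {}" using \<open>m > 0\<close> by auto
      have "real n \<le> 2 * real (card F)" using cardF by linarith
      also have "\<dots> = (\<Sum>p\<in>?P. 2 / m)" using \<open>m > 0\<close> by (simp add: card_cartesian_product)
      also have "\<dots> < (\<Sum>p\<in>?P. measure ?M\<^sub>0 (bad p))"
        using less \<open>?P \<noteq> {}\<close> \<open>finite F\<close> by (intro sum_strict_mono) auto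
      finally show False using sum_le by simp
    qed
    then obtain v s where vs: "v \<in> F" "s < m" and "measure ?M\<^sub>0 (bad (v, s)) \<le> 2 / m" by auto
    note Xvs = X[OF vs]
    let ?M = "measure_pmf (A ?f (X v s))"
    have valid_X: "valid_data V (X v s)" using Xvs EV unfolding valid_data_def by auto
    have "measure ?M (bad (v, s)) \<le> exp (\<epsilon> * k) * measure ?M\<^sub>0 (bad (v, s))"
      using is_DP_group[OF DP f _ valid_X X\<^sub>0(1)] X\<^sub>0(2) Xvs by auto
    also have "\<dots> \<le> exp (\<epsilon> * k) * (2 / m)"
      using \<open>measure ?M\<^sub>0 (bad (v, s)) \<le> 2 / m\<close> by (intro mult_left_mono) auto
    also have "\<dots> \<le> 1 / 2" using m \<open>m > 0\<close> by (simp add: field_simps)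
    finally have "measure ?M (- bad (v, s)) \<ge> 1 / 2"
      using measure_pmf.prob_compl[of "bad (v, s)" "A ?f (X v s)"] by (simp add: Compl_eq_Diff_UNIV)
    then have "k / 2 \<le> k * measure ?M (- bad (v, s))" using \<open>k > 0\<close> by (simp add: field_simps)
    also have "\<dots> = (\<integral>\<psi>. real k * indicator (- bad (v, s)) \<psi> \<partial>?M)" by simp
    also have "\<dots> \<le> (\<integral>\<psi>. cost_map d ?f (X v s) \<psi> \<partial>?M)"
    proof (rule integral_mono)
      \<comment> \<open>The finite support makes the cost integrable; the integral of a
        nonintegrable function would be \<open>0\<close> by convention.\<close>
      have "set_pmf (A ?f (X v s)) \<subseteq> V \<rightarrow>\<^sub>E V"
        using valid f valid_X unfolding valid_algo_def by blast
      then have "finite (set_pmf (A ?f (X v s)))"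
        by (rule finite_subset) (auto simp: V_def intro: finite_PiE)
      then show "integrable ?M (cost_map d ?f (X v s))"
        "integrable ?M (\<lambda>\<psi>. real k * indicator (- bad (v, s)) \<psi>)"
        by (rule integrable_measure_pmf_finite)+
      have "cost_map d ?f (X v s) \<psi> \<ge> 0" for \<psi>
        unfolding cost_map_def using d_nonneg by (intro add_nonneg_nonneg sum_nonneg sum_list_nonneg) auto
      then show "real k * indicator (- bad (v, s)) \<psi> \<le> cost_map d ?f (X v s) \<psi>" for \<psi>
        using cost_good[OF vs, of \<psi>] by (auto simp: indicator_def)
    qed
    also have "\<dots> \<le> \<alpha> * opt_cost V d ?f (X v s)"
      using ratio f valid_X unfolding has_approx_ratio_def by blast
    finally have le: "k / 2 \<le> \<alpha> * opt_cost V d ?f (X v s)" .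
    have "V \<noteq> {}" using \<open>n > 0\<close> unfolding V_def by auto
    then have opt0: "opt_cost V d ?f (X v s) \<ge> 0" by (rule opt_cost_nonneg[OF metric f valid_X])
    \<comment> \<open>The sign of \<open>\<alpha>\<close> is settled first, since replacing the
      optimum by its upper bound \<open>2\<close> requires a nonnegative factor.\<close>
    have "\<alpha> > 0"
    proof (rule ccontr)
      assume "\<not> \<alpha> > 0"
      then have "\<alpha> * opt_cost V d ?f (X v s) \<le> 0" using opt0 by (intro mult_nonpos_nonneg) auto
      moreover have "real k / 2 > 0" using \<open>k > 0\<close> by simp
      ultimately show False using le by linarith
    qed
    then have "\<alpha> * opt_cost V d ?f (X v s) \<le> \<alpha> * 2" using opt2[OF vs] by (intro mult_left_mono) auto
    then show ?thesis using le by linarith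
  qed
  moreover have "card V = n" unfolding V_def by simp
  ultimately show ?thesis using metric by blast
qed

text \<open>The vertex count is at most the exponential of
  \<open>3 * k * ln (8 * k) + 3 * \<epsilon> * k * k\<close>. The first bound on \<open>k\<close>
  makes \<open>k * ln (8 * k)\<close> at most \<open>L / 8\<close>, the second makes
  \<open>\<epsilon> * k * k\<close> at most \<open>L / 64\<close>, and 3/8 + 3/64 < 1.\<close>

lemma parameters_fit:
  fixes k :: nat and \<epsilon> L :: real
  assumes "k > 0" "\<epsilon> > 0" and L: "ln L \<ge> 1" "L > 0"
    and k: "k \<le> (L / ln L) / 8" "k \<le> sqrt (L / \<epsilon>) / 8"
  defines "m \<equiv> nat \<lceil>4 * exp (\<epsilon> * k)\<rceil>"
  shows "4 * exp (\<epsilon> * k) \<le> m" "real (2 * ((2 * k + 1) * (k * m) ^ (2 * k))) \<le> exp L"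
proof -
  show "4 * exp (\<epsilon> * k) \<le> m" unfolding m_def by (rule of_nat_ceiling)
  have e1: "exp (\<epsilon> * k) \<ge> 1" using \<open>\<epsilon> > 0\<close> by simp
  have "0 \<le> 4 * exp (\<epsilon> * k)" by simp
  then have "real m < 4 * exp (\<epsilon> * k) + 1" unfolding m_def by linarith
  then have m5: "m \<le> 5 * exp (\<epsilon> * k)" using e1 by linarith
  \<comment> \<open>A common bound for both factors: \<open>k * m\<close> is at most
    \<open>5 * k * exp (\<epsilon> * k)\<close>, where rounding up has turned 4 into 5, and
    \<open>4 * k + 2\<close> is at most \<open>8 * k\<close>.\<close>
  define a where "a = 8 * k * exp (\<epsilon> * k)"
  have "8 * real k * 1 \<le> 8 * real k * exp (\<epsilon> * k)" using e1 by (intro mult_left_mono) auto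
  then have a: "a \<ge> 8 * k" "a \<ge> 1" using \<open>k > 0\<close> unfolding a_def by linarith+
  have "real k * real m \<le> k * (5 * exp (\<epsilon> * k))" using m5 by (intro mult_left_mono) auto
  also have "\<dots> \<le> a" unfolding a_def by simp
  finally have km: "real (k * m) \<le> a" by simp
  have "real (2 * ((2 * k + 1) * (k * m) ^ (2 * k))) = (4 * k + 2) * real (k * m) ^ (2 * k)"
    by (simp add: algebra_simps)
  also have "\<dots> \<le> a * a ^ (2 * k)"
    using km a \<open>k > 0\<close> by (intro mult_mono power_mono) auto
  also have "\<dots> = a ^ (2 * k + 1)" by simp
  also have "\<dots> \<le> a ^ (3 * k)" using a \<open>k > 0\<close> by (intro power_increasing) auto
  also have "\<dots> = exp (3 * k * (ln (8 * k) + \<epsilon> * k))"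
  proof -
    have "a = exp (ln (8 * k) + \<epsilon> * k)" unfolding a_def using \<open>k > 0\<close> by (simp add: exp_add)
    then show ?thesis by (simp add: exp_of_nat_mult[symmetric])
  qed
  also have "\<dots> \<le> exp L"
  proof -
    have lnL: "ln L > 0" using L(1) by linarith
    have "8 * real k \<le> L / ln L" using k by simp
    also have "\<dots> \<le> L / 1" using L(2) lnL by (intro divide_left_mono) (use L(1) in linarith)+
    finally have "ln (8 * k) \<le> ln L" using \<open>k > 0\<close> L(2) by (subst ln_le_cancel_iff) auto
    then have "k * ln (8 * k) \<le> k * ln L" by (intro mult_left_mono) auto
    also have "\<dots> \<le> (L / ln L) / 8 * ln L" using k(1) lnL by (intro mult_right_mono) linarith+
    also have "\<dots> = L / 8" using less_imp_neq[OF lnL] by (auto simp del: ln_eq_zero_iff)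
    finally have 1: "k * ln (8 * k) \<le> L / 8" .
    have "(8 * real k)\<^sup>2 \<le> (sqrt (L / \<epsilon>))\<^sup>2" using k by (intro power_mono) auto
    also have "\<dots> = L / \<epsilon>" using L \<open>\<epsilon> > 0\<close> by simp
    finally have 2: "64 * (\<epsilon> * real k * real k) \<le> L" using \<open>\<epsilon> > 0\<close> by (simp add: field_simps power2_eq_square)
    have "3 * k * (ln (8 * k) + \<epsilon> * k) = 3 * (k * ln (8 * k)) + 3 * (\<epsilon> * real k * real k)"
      by (simp add: algebra_simps)
    also have "\<dots> \<le> L" using 1 2 L(2) by linarith
    finally show ?thesis by simp
  qed
  finally show "real (2 * ((2 * k + 1) * (k * m) ^ (2 * k))) \<le> exp L" .
qed

theorem theorem1:
  fixes \<epsilon>\<^sub>0 :: real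
  assumes "\<epsilon>\<^sub>0 > 0"
  shows "\<exists>c::real > 0. \<exists>N::nat. \<forall>\<epsilon>::real. \<forall>n::nat. 0 < \<epsilon> \<and> \<epsilon> \<le> \<epsilon>\<^sub>0 \<and> n \<ge> N \<longrightarrow>
    (\<exists>V d. card V = n \<and> finite_metric V d \<and>
      (\<forall>(A::algo) \<alpha>. valid_algo V A \<and> is_DP V \<epsilon> A \<and> has_approx_ratio V d A \<alpha> \<longrightarrow>
         \<alpha> \<ge> c * min (ln n / ln (ln n)) (sqrt (ln n / \<epsilon>))))"
proof -
  \<comment> \<open>The thresholds 16 and \<open>256 * \<epsilon>\<^sub>0\<close> make both terms of
    the minimum at least 16 for every admissible \<epsilon>, so that \<open>N\<close> depends on
    \<open>\<epsilon>\<^sub>0\<close> alone.\<close>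
  have "\<forall>\<^sub>F n::nat in sequentially. ln n / ln (ln n) \<ge> (16::real)" by real_asymp
  moreover have "\<forall>\<^sub>F n::nat in sequentially. ln n \<ge> 256 * \<epsilon>\<^sub>0" by real_asymp
  moreover have "\<forall>\<^sub>F n::nat in sequentially. ln (ln n) \<ge> (1::real)" by real_asymp
  moreover have "\<forall>\<^sub>F n::nat in sequentially. real n \<ge> 2" by real_asymp
  ultimately have "\<forall>\<^sub>F n::nat in sequentially. ln n / ln (ln n) \<ge> (16::real) \<and>
      ln n \<ge> 256 * \<epsilon>\<^sub>0 \<and> ln (ln n) \<ge> (1::real) \<and> real n \<ge> 2"
    by eventually_elim auto
  then obtain N :: nat where N: "\<forall>n\<ge>N. ln n / ln (ln n) \<ge> (16::real) \<and>
      ln n \<ge> 256 * \<epsilon>\<^sub>0 \<and> ln (ln n) \<ge> (1::real) \<and> real n \<ge> 2"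
    unfolding eventually_sequentially ..
  have "\<exists>V d. card V = n \<and> finite_metric V d \<and>
      (\<forall>(A::algo) \<alpha>. valid_algo V A \<and> is_DP V \<epsilon> A \<and> has_approx_ratio V d A \<alpha> \<longrightarrow>
         \<alpha> \<ge> 1 / 64 * min (ln n / ln (ln n)) (sqrt (ln n / \<epsilon>)))"
    if \<epsilon>: "0 < \<epsilon>" "\<epsilon> \<le> \<epsilon>\<^sub>0" and "n \<ge> N" for \<epsilon> :: real and n :: nat
  proof -
    define L M where "L = ln (real n)" and "M = min (L / ln L) (sqrt (L / \<epsilon>))"
    have L: "L / ln L \<ge> 16" "L \<ge> 256 * \<epsilon>\<^sub>0" "ln L \<ge> 1" "exp L = n"
      using N[rule_format, OF \<open>n \<ge> N\<close>] unfolding L_def by auto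
    have "L > 0" using L(2) assms by linarith
    have "256 \<le> L / \<epsilon>" using L(2) \<epsilon> by (simp add: field_simps)
    then have "sqrt (16\<^sup>2) \<le> sqrt (L / \<epsilon>)" by (intro real_sqrt_le_mono) simp
    then have M16: "M \<ge> 16" using L(1) unfolding M_def by simp
    \<comment> \<open>The factor 8 is the one in \<open>parameters_fit\<close>. Since
      \<open>M\<close> is at least 16, rounding down loses at most half: \<open>k\<close> is at
      least \<open>M / 16\<close>, whence \<open>k / 4\<close> is at least
      \<open>M / 64\<close>.\<close>
    define k where "k = nat \<lfloor>M / 8\<rfloor>"
    have k: "k \<le> M / 8" "M / 8 - 1 < k" using M16 unfolding k_def by linarith+
    then have "k > 0" using M16 by (auto intro: gr0I)
    have k': "k \<le> (L / ln L) / 8" "k \<le> sqrt (L / \<epsilon>) / 8" using k(1) unfolding M_def by auto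
    note fit = parameters_fit[OF \<open>k > 0\<close> \<epsilon>(1) L(3) \<open>L > 0\<close> k']
    have "2 * ((2 * k + 1) * (k * nat \<lceil>4 * exp (\<epsilon> * k)\<rceil>) ^ (2 * k)) \<le> n"
      using fit(2) unfolding L(4) of_nat_le_iff .
    from private_facility_location_lower_bound[OF \<open>k > 0\<close> fit(1) this]
    obtain V d where Vd: "card V = n" "finite_metric V d"
      "\<And>A \<alpha>. valid_algo V A \<Longrightarrow> is_DP V \<epsilon> A \<Longrightarrow> has_approx_ratio V d A \<alpha> \<Longrightarrow> k / 4 \<le> \<alpha>"
      by blast
    have "1 / 64 * M \<le> k / 4" using k M16 by linarith
    then have "1 / 64 * M \<le> \<alpha>"
      if "valid_algo V A" "is_DP V \<epsilon> A" "has_approx_ratio V d A \<alpha>" for A \<alpha>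
      using Vd(3)[OF that] by linarith
    then show ?thesis using Vd(1,2) unfolding M_def L_def by blast
  qed
  then show ?thesis by (intro exI[of _ "1 / 64"] exI[of _ N] conjI) auto
qed

end
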